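(* Let $t\ge 2$ be an integer and let $v$ be a prime power. Then \[ d(t,v)\le\frac{v(v-1)(t-1)}{\log\left(\frac{v^{t-1}}{v^{t-1}-v+1}\right)} . \]
   Context: The logarithm is the natural logarithm. For positive integers $N,t,k,v$ with $k\ge t\ge 2$ and $v\ge 2$, a covering array $\mathsf{CA}(N;t,k,v)$ is an $N\times k$ array $A$ with entries from an alphabet $\Sigma$ of size $v$ such that for every $N\times t$ subarray $B$ of $A$ (obtained by choosing $t$ of the $k$ columns) and every $\mathbf{x}\in\Sigma^{t}$, some row of $B$ equals $\mathbf{x}$. $\mathsf{CAN}(t,k,v)$ is the smallest $N$ for which a $\mathsf{CA}(N;t,k,v)$ exists. Define \[ d(t,v)=\limsup_{k\to\infty}\frac{\mathsf{CAN}(t,k,v)}{\log k}. \] A prime power is an integer $p^m$ with $p$ prime and $m\ge 1$. *)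

theory Defs
  imports
    Complex_Main
    "HOL-Library.FuncSet"
    "HOL-Library.Extended_Real"
    "HOL-Number_Theory.Prime_Powers"
begin

(* Rows are indexed by {..<N} and columns by {..<k}; values of A outside this range are
   irrelevant.  A choice of t columns is a set T of column indices, and a word of length t over
   the alphabet S is given by its entry in each column of T. *)
definition covering_array ::
    "'a set \<Rightarrow> nat \<Rightarrow> nat \<Rightarrow> nat \<Rightarrow> nat \<Rightarrow> (nat \<Rightarrow> nat \<Rightarrow> 'a) \<Rightarrow> bool" where
  "covering_array S N t k v A \<longleftrightarrow>
     finite S \<and> card S = v \<and>
     (\<forall>r<N. \<forall>c<k. A r c \<in> S) \<and>
     (\<forall>T. T \<subseteq> {..<k} \<and> card T = t \<longrightarrow>
        (\<forall>x \<in> T \<rightarrow>\<^sub>E S. \<exists>r<N. \<forall>c\<in>T. A r c = x c))"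

(* Only meaningful for k \<ge> t \<ge> 2 and v \<ge> 2; there N = 0 is never attained, and a covering
   array always exists.  Renaming symbols preserves covering arrays, so alphabets of natural
   numbers suffice. *)
definition CAN :: "nat \<Rightarrow> nat \<Rightarrow> nat \<Rightarrow> nat" where
  "CAN t k v = (LEAST N. \<exists>(S :: nat set) A. covering_array S N t k v A)"

(* Taken in the extended reals, so that an upper bound on it includes finiteness. *)
definition d :: "nat \<Rightarrow> nat \<Rightarrow> ereal" where
  "d t v = limsup (\<lambda>k. ereal (real (CAN t k v) / ln (real k)))"

end

theory Submission
  imports Defs "HOL-Algebra.Algebraic_Closure" "HOL-Number_Theory.Residues"
begin

text \<open>The v(v - 1) affine maps x \<mapsto> ax + b with a \<noteq> 0 over a field S of order v are determined by their
  values at any two points. Hence, for a non-constant word x on t columns, the rows having x in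
  their orbit form a fraction \<rho> = (v - 1)/v^(t-1) of all rows. By averaging, rows can be chosen
  greedily so that each one covers a fraction \<rho> of the pairs (T, x) not yet covered, and n rows on
  2k columns leave at most (2k)^t v^t (1 - \<rho>)^n pairs. Once this is at most k, which takes
  n = (t - 1) log k / (- log (1 - \<rho>)) + O(1), deleting one column from each bad set T leaves at least
  k columns; this deletion is what saves the factor t - 1 instead of t. The orbits of the n rows,
  with v constant rows added, form a covering array with v(v - 1)n + v rows.

  The field of order q = p^m consists of the roots of X^q - X in an algebraic closure of the
  integers modulo p.\<close>

section \<open>Affine maps over a finite field\<close>

lemma (in cring) binomial_expansion:
  assumes x: "x \<in> carrier R" and y: "y \<in> carrier R"
  shows "(x \<oplus> y) [^] n = (\<Oplus>k\<in>{..n}. [(n choose k)] \<cdot> (x [^] k \<otimes> y [^] (n - k)))"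
proof (induction n)
  case 0
  then show ?case using x y by simp
next
  case (Suc n)
  let ?S = "\<Oplus>k\<in>{..n}. [(n choose k)] \<cdot> (x [^] k \<otimes> y [^] (n - k))"
  have cl: "[(c::nat)] \<cdot> (x [^] (k::nat) \<otimes> y [^] (l::nat)) \<in> carrier R" for c k l
    using x y by simp
  have ex: "x [^] k \<otimes> y [^] l \<otimes> x = x [^] Suc k \<otimes> y [^] l"
    and ey: "x [^] k \<otimes> y [^] l \<otimes> y = x [^] k \<otimes> y [^] Suc l" for k l :: nat
    using x y by (simp_all add: m_ac)
  have "?S \<otimes> x = (\<Oplus>k\<in>{..n}. [(n choose k)] \<cdot> (x [^] k \<otimes> y [^] (n - k)) \<otimes> x)"
    using x cl by (intro finsum_ldistr) auto
  also have "\<dots> = (\<Oplus>k\<in>{..n}. [(n choose k)] \<cdot> (x [^] Suc k \<otimes> y [^] (n - k)))"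
    using x y by (intro finsum_cong') (auto simp: add_pow_ldistr ex simp del: nat_pow_Suc)
  finally have 1: "?S \<otimes> x = (\<Oplus>k\<in>{..n}. [(n choose k)] \<cdot> (x [^] Suc k \<otimes> y [^] (n - k)))" .
  have "?S \<otimes> y = (\<Oplus>k\<in>{..n}. [(n choose k)] \<cdot> (x [^] k \<otimes> y [^] (n - k)) \<otimes> y)"
    using y cl by (intro finsum_ldistr) auto
  also have "\<dots> = (\<Oplus>k\<in>{..n}. [(n choose k)] \<cdot> (x [^] k \<otimes> y [^] (Suc n - k)))"
    using x y by (intro finsum_cong') (auto simp: add_pow_ldistr ey Suc_diff_le simp del: nat_pow_Suc)
  \<comment> \<open>The added term k = n + 1 is zero since its binomial coefficient vanishes.
    Splitting off k = 0 instead shifts the index, which aligns this sum with the one for x so that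
    Pascal's rule applies termwise.\<close>
  also have "\<dots> = (\<Oplus>k\<in>{..Suc n}. [(n choose k)] \<cdot> (x [^] k \<otimes> y [^] (Suc n - k)))"
    using x y cl by (subst finsum_Suc) (auto simp: binomial_eq_0)
  also have "\<dots> = (\<Oplus>k\<in>{..n}. [(n choose Suc k)] \<cdot> (x [^] Suc k \<otimes> y [^] (n - k)))
      \<oplus> [(1::nat)] \<cdot> (x [^] (0::nat) \<otimes> y [^] Suc n)"
    using cl x y by (subst finsum_Suc2) (auto simp del: nat_pow_Suc)
  finally have 2: "?S \<otimes> y = \<dots>" .
  have "(x \<oplus> y) [^] Suc n = ?S \<otimes> x \<oplus> ?S \<otimes> y"
    using Suc x y cl by (simp add: r_distr)
  also have "\<dots> = (\<Oplus>k\<in>{..n}. [(n choose k)] \<cdot> (x [^] Suc k \<otimes> y [^] (n - k))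
      \<oplus> [(n choose Suc k)] \<cdot> (x [^] Suc k \<otimes> y [^] (n - k)))
      \<oplus> [(1::nat)] \<cdot> (x [^] (0::nat) \<otimes> y [^] Suc n)"
    unfolding 1 2 using x y by (subst finsum_addf) (auto simp: a_assoc)
  also have "\<dots> = (\<Oplus>k\<in>{..n}. [(Suc n choose Suc k)] \<cdot> (x [^] Suc k \<otimes> y [^] (Suc n - Suc k)))
      \<oplus> [(Suc n choose 0)] \<cdot> (x [^] (0::nat) \<otimes> y [^] (Suc n - 0))"
    using x y by (simp add: add.nat_pow_mult del: nat_pow_Suc)
  also have "\<dots> = (\<Oplus>k\<in>{..Suc n}. [(Suc n choose k)] \<cdot> (x [^] k \<otimes> y [^] (Suc n - k)))"
    using cl by (subst finsum_Suc2) auto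
  finally show ?case .
qed

text \<open>For exponent p every binomial coefficient strictly between the ends is divisible by p,
  so only the two pure powers survive; iterating m times gives p^m.\<close>

lemma (in cring) frobenius_add:
  assumes p: "Factorial_Ring.prime (p::nat)" and char: "[p] \<cdot> \<one> = \<zero>"
    and x: "x \<in> carrier R" and y: "y \<in> carrier R"
  shows "(x \<oplus> y) [^] (p ^ m) = x [^] (p ^ m) \<oplus> y [^] (p ^ m)"
proof (induction m)
  case 0
  then show ?case using x y by simp
next
  case (Suc m)
  have step: "(u \<oplus> w) [^] p = u [^] p \<oplus> w [^] p" if u: "u \<in> carrier R" and w: "w \<in> carrier R" for u w
  proof -
    have pz: "[p] \<cdot> z = \<zero>" if "z \<in> carrier R" for z
      using add_pow_ldistr[of \<one> z p] that char by simp
    have mid: "[(p choose k)] \<cdot> (u [^] k \<otimes> w [^] (p - k)) = \<zero>" if "0 < k" "k < p" for k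
    proof -
      have "p dvd (p choose k)" using that by (intro dvd_choose_prime p) auto
      then obtain j where j: "p choose k = p * j" by (rule dvdE)
      have "[(p choose k)] \<cdot> z = [p] \<cdot> ([j] \<cdot> z)" if "z \<in> carrier R" for z
        using add.nat_pow_pow[OF that, of p j] by (simp only: j mult.commute[of p j])
      then show ?thesis using pz u w by simp
    qed
    obtain q where q: "p = Suc q" using prime_gt_0_nat[OF p] gr0_conv_Suc[of p] by blast
    have "(u \<oplus> w) [^] p = (\<Oplus>k\<in>{..p}. if k = 0 then w [^] p else if k = p then u [^] p else \<zero>)"
      unfolding binomial_expansion[OF u w]
      using u w q mid by (intro finsum_cong') (auto simp del: nat_pow_Suc)
    also have "\<dots> = u [^] p \<oplus> w [^] p"
    proof -
      have "(\<Oplus>k\<in>{..q}. if k = 0 then w [^] p else if k = p then u [^] p else \<zero>)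
          = (\<Oplus>k\<in>{..q}. if 0 = k then w [^] p else \<zero>)"
        using u w q by (intro finsum_cong') auto
      also have "\<dots> = w [^] p"
        using w by (intro finsum_singleton) auto
      finally show ?thesis unfolding q using u w
        by (subst finsum_Suc) (auto simp del: nat_pow_Suc simp flip: q)
    qed
    finally show ?thesis .
  qed
  have "(x \<oplus> y) [^] (p ^ Suc m) = ((x \<oplus> y) [^] (p ^ m)) [^] p"
    using x y by (simp add: nat_pow_pow mult.commute)
  also have "\<dots> = (x [^] (p ^ m)) [^] p \<oplus> (y [^] (p ^ m)) [^] p"
    unfolding Suc using x y by (simp add: step)
  also have "\<dots> = x [^] (p ^ Suc m) \<oplus> y [^] (p ^ Suc m)"
    using x y by (simp add: nat_pow_pow mult.commute)
  finally show ?case .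
qed

section \<open>The field of order p^m inside an algebraically closed field\<close>

lemma (in ring_hom_ring) hom_char:
  assumes "[(n::nat)] \<cdot>\<^bsub>R\<^esub> \<one>\<^bsub>R\<^esub> = \<zero>\<^bsub>R\<^esub>"
  shows "[n] \<cdot>\<^bsub>S\<^esub> \<one>\<^bsub>S\<^esub> = \<zero>\<^bsub>S\<^esub>"
proof -
  have "h ([n] \<cdot>\<^bsub>R\<^esub> \<one>\<^bsub>R\<^esub>) = [n] \<cdot>\<^bsub>S\<^esub> \<one>\<^bsub>S\<^esub>"
    by (induction n) auto
  then show ?thesis using assms by simp
qed


text \<open>The fixed points are the roots of X^q - X with q = p^m. This polynomial splits, so it
  has q roots with multiplicity, and every root turns out to be simple.\<close>

lemma (in algebraically_closed) card_frobenius_fixed_points: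
  assumes p: "Factorial_Ring.prime (p::nat)" and char: "[p] \<cdot> \<one> = \<zero>" and m: "m > 0"
  shows "card {x \<in> carrier L. x [^] (p ^ m) = x} = p ^ m"
proof -
  define q where "q = p ^ m"
  have q: "q > 1" unfolding q_def by (rule one_less_power[OF prime_gt_1_nat[OF p] m])
  interpret UP: domain "poly_ring L"
    using univ_poly_is_domain[OF carrier_is_subring] .
  interpret emb: ring_hom_ring L "poly_ring L" poly_of_const
    using canonical_embedding_ring_hom[OF carrier_is_subring] by simp
  have UPchar: "[p] \<cdot>\<^bsub>poly_ring L\<^esub> \<one>\<^bsub>poly_ring L\<^esub> = \<zero>\<^bsub>poly_ring L\<^esub>"
    using emb.hom_char char .
  have X: "X \<in> carrier (poly_ring L)" "polynomial (carrier L) X"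
    using var_closed[OF carrier_is_subring] by simp_all
  let ?m = "\<ominus>\<^bsub>poly_ring L\<^esub> X"
  define P where "P = X [^]\<^bsub>poly_ring L\<^esub> q \<oplus>\<^bsub>poly_ring L\<^esub> ?m"
  have P: "P \<in> carrier (poly_ring L)" unfolding P_def using X by simp
  have degX: "degree X = 1" by (simp add: var_def)
  have degP: "degree P = q"
  proof -
    have "degree P = max (degree (X [^]\<^bsub>poly_ring L\<^esub> q)) (degree ?m)"
      unfolding P_def univ_poly_add
    proof (rule poly_add_degree_eq[OF carrier_is_subring])
      show "polynomial (carrier L) (X [^]\<^bsub>poly_ring L\<^esub> q)" "polynomial (carrier L) ?m"
        unfolding univ_poly_carrier using X(1) by (rule UP.nat_pow_closed UP.a_inv_closed)+
      show "degree (X [^]\<^bsub>poly_ring L\<^esub> q) \<noteq> degree ?m"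
        unfolding polynomial_pow_degree[OF X(1)] univ_poly_a_inv_degree[OF carrier_is_subring X(1)] degX
        using q by simp
    qed
    then show ?thesis
      using q polynomial_pow_degree[OF X(1)] univ_poly_a_inv_degree[OF carrier_is_subring X(1)] degX
      by simp
  qed
  then have P0: "P \<noteq> []" using q by auto
  have evalP: "eval P x = x [^] q \<ominus> x" if x: "x \<in> carrier L" for x
  proof -
    interpret ev: ring_hom_ring "poly_ring L" L "\<lambda>f. eval f x"
      using eval_is_hom[OF carrier_is_subring x] UP.ring_axioms ring_axioms by (intro ring_hom_ringI2)
    show ?thesis unfolding P_def using X x by (simp add: ev.hom_nat_pow eval_var a_minus_def)
  qed
  have root_iff: "x \<in># roots P \<longleftrightarrow> x \<in> carrier L \<and> x [^] q = x" for x
    using evalP P0 unfolding roots_mem_iff_is_root[OF P] is_root_def by auto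
  have "count (roots P) a = 1" if "a \<in># roots P" for a
  proof -
    from that have a: "a \<in> carrier L" and aq: "a [^] q = a" using root_iff by auto
    define A where "A = poly_of_const a"
    have A: "A \<in> carrier (poly_ring L)" unfolding A_def using a by simp
    have Aq: "A [^]\<^bsub>poly_ring L\<^esub> q = A" unfolding A_def using a aq by (metis emb.hom_nat_pow)
    let ?l = "[\<one>, \<ominus> a]"
    have l: "?l \<in> carrier (poly_ring L)"
      using a by (simp add: univ_poly_def polynomial_def)
    \<comment> \<open>\<open>?l\<close> is X - a. Writing X = (X - a) + a lets Frobenius, applied in
      the polynomial ring, expand X^q around the root a.\<close>
    have lA: "?l \<oplus>\<^bsub>poly_ring L\<^esub> A = X"
      using a unfolding A_def poly_of_const_def var_def univ_poly_add by (auto simp: l_neg)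
    have "X [^]\<^bsub>poly_ring L\<^esub> q = ?l [^]\<^bsub>poly_ring L\<^esub> q \<oplus>\<^bsub>poly_ring L\<^esub> A"
      using UP.frobenius_add[OF p UPchar l A, of m] lA Aq unfolding q_def by simp
    then have "P = ?l [^]\<^bsub>poly_ring L\<^esub> q \<oplus>\<^bsub>poly_ring L\<^esub> A \<oplus>\<^bsub>poly_ring L\<^esub>
        (\<ominus>\<^bsub>poly_ring L\<^esub> (?l \<oplus>\<^bsub>poly_ring L\<^esub> A))"
      unfolding P_def lA by simp
    also have "\<dots> = ?l [^]\<^bsub>poly_ring L\<^esub> q \<ominus>\<^bsub>poly_ring L\<^esub> ?l"
    proof -
      have "?l [^]\<^bsub>poly_ring L\<^esub> q \<in> carrier (poly_ring L)" using l by simp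
      then show ?thesis using l A by algebra
    qed
    finally have P1: "P = ?l [^]\<^bsub>poly_ring L\<^esub> q \<ominus>\<^bsub>poly_ring L\<^esub> ?l" .
    \<comment> \<open>Two successors are split off so that the power left after removing one factor
      X - a still vanishes at a.\<close>
    obtain r where r: "q = Suc (Suc r)" using q that[of "q - 2"] by simp
    \<comment> \<open>Since a is fixed by Frobenius, X^q - X = (X - a)^q - (X - a) = (X - a) Q,
        and Q(a) = -1, so a is a simple root.\<close>
    define Q where "Q = ?l [^]\<^bsub>poly_ring L\<^esub> Suc r \<ominus>\<^bsub>poly_ring L\<^esub> \<one>\<^bsub>poly_ring L\<^esub>"
    have lr: "?l [^]\<^bsub>poly_ring L\<^esub> Suc r \<in> carrier (poly_ring L)" using UP.nat_pow_closed[OF l] .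
    have Q: "Q \<in> carrier (poly_ring L)" unfolding Q_def using lr by simp
    have PQ: "P = ?l \<otimes>\<^bsub>poly_ring L\<^esub> Q"
    proof -
      have "P = ?l [^]\<^bsub>poly_ring L\<^esub> Suc r \<otimes>\<^bsub>poly_ring L\<^esub> ?l \<ominus>\<^bsub>poly_ring L\<^esub> ?l"
        unfolding P1 r UP.nat_pow_Suc[of _ "Suc r"] ..
      also have "\<dots> = ?l \<otimes>\<^bsub>poly_ring L\<^esub> Q"
        unfolding Q_def using l lr
        by (simp only: a_minus_def UP.r_distr UP.r_minus UP.r_one UP.l_one UP.m_comm UP.one_closed UP.a_inv_closed)
      finally show ?thesis .
    qed
    interpret ev: ring_hom_ring "poly_ring L" L "\<lambda>f. eval f a"
      using eval_is_hom[OF carrier_is_subring a] UP.ring_axioms ring_axioms by (intro ring_hom_ringI2)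
    have el: "eval ?l a = \<zero>" using a by (simp add: r_neg)
    have "eval Q a = eval (?l [^]\<^bsub>poly_ring L\<^esub> r) a \<otimes> eval ?l a \<ominus> \<one>"
      unfolding Q_def a_minus_def using l UP.nat_pow_closed[OF l, of r] by simp
    then have evQ: "eval Q a = \<ominus> \<one>"
      unfolding el using UP.nat_pow_closed[OF l, of r] by (simp add: a_minus_def)
    then have nz: "eval Q a \<noteq> \<zero>" by (metis minus_minus minus_zero one_closed one_not_zero)
    then have "Q \<noteq> []" by auto
    then have "roots P = add_mset a (roots Q)"
      unfolding PQ using poly_mult_degree_one_monic_imp_same_roots[OF a Q] by simp
    moreover have "a \<notin># roots Q"
      using nz unfolding roots_mem_iff_is_root[OF Q] is_root_def by simp
    ultimately show ?thesis by (simp add: not_in_iff)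
  qed
  then have "size (roots P) = card (set_mset (roots P))"
    by (simp add: size_multiset_overloaded_eq)
  moreover have "size (roots P) = q"
    using roots_over_carrier[OF P] degP unfolding splitted_def by simp
  moreover have "set_mset (roots P) = {x \<in> carrier L. x [^] q = x}"
    using root_iff by auto
  ultimately show ?thesis unfolding q_def by simp
qed

section \<open>Sharply 2-transitive families of permutations\<close>

text \<open>A sharp family of the maximal size v(v - 1) is a sharply 2-transitive set of permutations;
  closure under composition is never needed.\<close>

definition sharp_family :: "'a set \<Rightarrow> ('a \<Rightarrow> 'a) set \<Rightarrow> bool" where
  "sharp_family S G \<longleftrightarrow> (\<forall>g\<in>G. bij_betw g S S) \<and>
     (\<forall>g\<in>G. \<forall>h\<in>G. \<forall>x\<in>S. \<forall>y\<in>S. x \<noteq> y \<longrightarrow> g x = h x \<longrightarrow> g y = h y \<longrightarrow> g = h)"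

text \<open>The maps x \<mapsto> ax + b on \<open>K\<close> with a nonzero are carried over to
  \<open>S\<close> by a bijection. Cancelling a in the domain gives injectivity, and finiteness then
  gives surjectivity.\<close>

lemma (in domain) exists_sharp_family:
  assumes K: "K \<subseteq> carrier R" "finite K" "\<zero> \<in> K"
    and add: "\<And>x y. x \<in> K \<Longrightarrow> y \<in> K \<Longrightarrow> x \<oplus> y \<in> K"
    and mult: "\<And>x y. x \<in> K \<Longrightarrow> y \<in> K \<Longrightarrow> x \<otimes> y \<in> K"
    and S: "finite S" "card S = card K" and two: "card S \<ge> 2"
  shows "\<exists>G. sharp_family S G \<and> finite G \<and> card G = card S * (card S - 1)"
proof -
  obtain \<phi> where \<phi>: "bij_betw \<phi> S K"
    using finite_same_card_bij[OF S(1) K(2) S(2)] by blast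
  define \<psi> where "\<psi> = the_inv_into S \<phi>"
  have \<psi>: "bij_betw \<psi> K S" unfolding \<psi>_def using \<phi> by (rule bij_betw_the_inv_into)
  define F where "F = (\<lambda>(a, b). \<lambda>x\<in>S. \<psi> (a \<otimes> \<phi> x \<oplus> b))"
  let ?D = "(K - {\<zero>}) \<times> K"
  have \<phi>K: "\<phi> x \<in> K" if "x \<in> S" for x using \<phi> that by (auto simp: bij_betw_def)
  have \<psi>_eq: "\<psi> u = \<psi> w \<longleftrightarrow> u = w" if "u \<in> K" "w \<in> K" for u w
    using \<psi> that by (auto simp: bij_betw_def inj_on_def)
  have \<phi>_eq: "\<phi> x = \<phi> y \<longleftrightarrow> x = y" if "x \<in> S" "y \<in> S" for x y
    using \<phi> that by (auto simp: bij_betw_def inj_on_def)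
  have bij: "bij_betw (F z) S S" if z: "z \<in> ?D" for z
  proof -
    obtain a b where ab: "z = (a, b)" "a \<in> K" "a \<noteq> \<zero>" "b \<in> K" using z by auto
    have "inj_on (F z) S"
    proof (rule inj_onI)
      fix x y assume xy: "x \<in> S" "y \<in> S" "F z x = F z y"
      then have "a \<otimes> \<phi> x \<oplus> b = a \<otimes> \<phi> y \<oplus> b"
        using ab \<phi>K add mult by (simp add: F_def \<psi>_eq)
      moreover have "a \<in> carrier R" "b \<in> carrier R" "\<phi> x \<in> carrier R" "\<phi> y \<in> carrier R"
        using ab xy \<phi>K K(1) by auto
      ultimately have "\<phi> x = \<phi> y" using ab(3) by (simp add: m_lcancel)
      then show "x = y" using xy \<phi>_eq by simp
    qed
    moreover have "F z ` S \<subseteq> S"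
      using ab \<phi>K add mult \<psi> by (auto simp: F_def bij_betw_def)
    ultimately show ?thesis using endo_inj_surj[OF S(1)] by (auto simp: bij_betw_def)
  qed
  have sep: "z = z'" if z: "z \<in> ?D" "z' \<in> ?D" and xy: "x \<in> S" "y \<in> S" "x \<noteq> y"
    and eq: "F z x = F z' x" "F z y = F z' y" for z z' x y
  proof -
    obtain a b where ab: "z = (a, b)" "a \<in> K" "b \<in> K" using z by auto
    obtain c e where ce: "z' = (c, e)" "c \<in> K" "e \<in> K" using z by auto
    have cl: "a \<in> carrier R" "b \<in> carrier R" "c \<in> carrier R" "e \<in> carrier R"
      "\<phi> x \<in> carrier R" "\<phi> y \<in> carrier R"
      using ab ce xy \<phi>K K by auto
    have 1: "a \<otimes> \<phi> x \<oplus> b = c \<otimes> \<phi> x \<oplus> e" and 2: "a \<otimes> \<phi> y \<oplus> b = c \<otimes> \<phi> y \<oplus> e"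
      using eq xy ab ce \<phi>K add mult by (simp_all add: F_def \<psi>_eq)
    \<comment> \<open>Subtracting the two equations eliminates the translations b and e, leaving a
      product that must be zero.\<close>
    have "(a \<ominus> c) \<otimes> (\<phi> x \<ominus> \<phi> y)
        = (a \<otimes> \<phi> x \<oplus> b) \<ominus> (c \<otimes> \<phi> x \<oplus> e) \<ominus> ((a \<otimes> \<phi> y \<oplus> b) \<ominus> (c \<otimes> \<phi> y \<oplus> e))"
      using cl by algebra
    also have "\<dots> = \<zero>" unfolding 1 2 using cl by algebra
    finally have "a = c \<or> \<phi> x = \<phi> y"
      using integral[of "a \<ominus> c" "\<phi> x \<ominus> \<phi> y"] cl by simp
    then have "a = c" using xy \<phi>_eq by simp
    moreover from this have "b = e" using 1 cl by simp
    ultimately show ?thesis using ab ce by simp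
  qed
  \<comment> \<open>Agreement at two points determines the parameters, so distinct parameters give
    distinct maps and the family has its full size.\<close>
  obtain x y where xy: "x \<in> S" "y \<in> S" "x \<noteq> y"
    using two S(1) by (metis One_nat_def card_le_Suc0_iff_eq not_less_eq_eq numeral_2_eq_2)
  have "inj_on F ?D"
  proof (rule inj_onI)
    fix z z' assume "z \<in> ?D" "z' \<in> ?D" "F z = F z'"
    then show "z = z'" using sep[of z z', OF _ _ xy] by simp
  qed
  then have "card (F ` ?D) = card S * (card S - 1)"
    using K S by (simp add: card_image card_cartesian_product mult.commute)
  moreover have "sharp_family S (F ` ?D)"
    unfolding sharp_family_def
  proof (intro conjI ballI impI)
    show "bij_betw g S S" if "g \<in> F ` ?D" for g using that bij by force
    fix g h x y
    assume gh: "g \<in> F ` ?D" "h \<in> F ` ?D" and xy: "x \<in> S" "y \<in> S" "x \<noteq> y" "g x = h x" "g y = h y"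
    from gh(1) obtain z where z: "g = F z" "z \<in> ?D" by (rule imageE)
    from gh(2) obtain z' where z': "h = F z'" "z' \<in> ?D" by (rule imageE)
    have "z = z'" using sep[OF z(2) z'(2) xy(1-3)] xy(4,5) z(1) z'(1) by simp
    then show "g = h" using z z' by simp
  qed
  ultimately show ?thesis using K(2) by blast
qed

text \<open>\<open>K\<close> is the field of order v: the fixed points of x \<mapsto> x^v in an
  algebraic closure of the integers mod p. Closure under addition is additivity of
  Frobenius.\<close>

lemma exists_sharp_family_primepow:
  assumes v: "primepow v" and S: "finite S" "card S = v"
  shows "\<exists>G. sharp_family S G \<and> finite G \<and> card G = v * (v - 1)"
proof -
  obtain p m where p: "Factorial_Ring.prime p" and m: "m > 0" and vpm: "v = p ^ m"
    using v unfolding primepow_def by blast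
  interpret residues_prime p "residue_ring (int p)"
    using p by unfold_locales simp_all
  obtain L :: "((int list \<times> nat) multiset \<Rightarrow> int) ring"
    where L: "algebraic_closure L (indexed_const ` carrier (residue_ring (int p)))"
    and hom: "indexed_const \<in> ring_hom (residue_ring (int p)) L"
    by (rule that[OF field.alg_closureE[OF is_field]])
  interpret L: algebraic_closure L "indexed_const ` carrier (residue_ring (int p))" by (rule L)
  interpret h: ring_hom_ring "residue_ring (int p)" L indexed_const
    by (rule ring_hom_ringI2[OF field.is_ring[OF is_field] L.ring_axioms hom])
  have "[n] \<cdot>\<^bsub>residue_ring (int p)\<^esub> \<one>\<^bsub>residue_ring (int p)\<^esub> = int n mod int p" for n :: nat
    by (induction n) (auto simp: res_zero_eq res_one_eq res_add_eq mod_simps add.commute)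
  then have "[p] \<cdot>\<^bsub>residue_ring (int p)\<^esub> \<one>\<^bsub>residue_ring (int p)\<^esub> = \<zero>\<^bsub>residue_ring (int p)\<^esub>"
    by (simp add: res_zero_eq)
  then have char: "[p] \<cdot>\<^bsub>L\<^esub> \<one>\<^bsub>L\<^esub> = \<zero>\<^bsub>L\<^esub>" by (rule h.hom_char)
  define K where "K = {x \<in> carrier L. x [^]\<^bsub>L\<^esub> (p ^ m) = x}"
  have cK: "card K = v"
    unfolding K_def vpm using L.card_frobenius_fixed_points[OF p char m] .
  have v2: "v \<ge> 2" using primepow_gt_Suc_0[OF v] by simp
  have "\<exists>G. sharp_family S G \<and> finite G \<and> card G = card S * (card S - 1)"
  proof (rule L.exists_sharp_family[of K])
    show "K \<subseteq> carrier L" unfolding K_def by blast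
    \<comment> \<open>An infinite set has \<open>card\<close> 0, whereas \<open>card K\<close> is at
      least 2.\<close>
    show "finite K" using cK v2 card.infinite by fastforce
    show "\<zero>\<^bsub>L\<^esub> \<in> K" unfolding K_def using prime_gt_0_nat[OF p] by (simp add: L.nat_pow_zero)
    show "x \<oplus>\<^bsub>L\<^esub> y \<in> K" "x \<otimes>\<^bsub>L\<^esub> y \<in> K" if "x \<in> K" "y \<in> K" for x y
      using that L.frobenius_add[OF p char, of x y m] unfolding K_def
      by (auto simp: L.nat_pow_distrib)
  qed (use S cK v2 in simp_all)
  then show ?thesis using S by simp
qed

section \<open>Covering arrays from sharp families\<close>

text \<open>Greedy choice: counting incidences between rows and the remaining elements in two ways
  yields a row that handles at least a fraction \<rho> of them. Each round thus shrinks the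
  remainder by the factor 1 - \<rho>.\<close>

lemma exists_list_covering:
  fixes \<rho> :: real
  assumes R: "finite R" "R \<noteq> {}" and U: "finite U" and \<rho>: "\<rho> \<le> 1"
    and cov: "\<And>u. u \<in> U \<Longrightarrow> \<rho> * card R \<le> card {r \<in> R. P r u}"
  shows "\<exists>rs. length rs = n \<and> set rs \<subseteq> R \<and> card {u \<in> U. \<forall>r\<in>set rs. \<not> P r u} \<le> (1 - \<rho>) ^ n * card U"
proof (induction n)
  case 0
  then show ?case by simp
next
  case (Suc n)
  then obtain rs where rs: "length rs = n" "set rs \<subseteq> R"
    "card {u \<in> U. \<forall>r\<in>set rs. \<not> P r u} \<le> (1 - \<rho>) ^ n * card U" by blast
  define W where "W = {u \<in> U. \<forall>r\<in>set rs. \<not> P r u}"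
  have W: "finite W" unfolding W_def using U by simp
  have "\<exists>r\<in>R. \<rho> * card W \<le> card {u \<in> W. P r u}"
  proof (rule ccontr)
    assume "\<not> ?thesis"
    then have "(\<Sum>r\<in>R. real (card {u \<in> W. P r u})) < (\<Sum>r\<in>R. \<rho> * card W)"
      using R by (intro sum_strict_mono) auto
    also have "\<dots> = (\<Sum>u\<in>W. \<rho> * card R)" by simp
    also have "\<dots> \<le> (\<Sum>u\<in>W. real (card {r \<in> R. P r u}))"
      using cov unfolding W_def by (intro sum_mono) auto
    also have "\<dots> = (\<Sum>r\<in>R. real (card {u \<in> W. P r u}))"
      using sum_multicount_gen[OF W R(1), of "\<lambda>u r. P r u" "\<lambda>r. card {u \<in> W. P r u}"]
      by (simp flip: of_nat_sum)
    finally show False by simp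
  qed
  then obtain r where r: "r \<in> R" "\<rho> * card W \<le> card {u \<in> W. P r u}" by blast
  have "card {u \<in> W. \<not> P r u} + card {u \<in> W. P r u} = card W"
    using W by (subst card_Un_disjoint[symmetric]) (auto intro: arg_cong[where f = card])
  then have "card {u \<in> W. \<not> P r u} \<le> (1 - \<rho>) * card W"
    using r(2) by (simp add: algebra_simps flip: of_nat_add)
  \<comment> \<open>Here \<rho> \<le> 1 is what makes the factor 1 - \<rho> nonnegative.\<close>
  also have "\<dots> \<le> (1 - \<rho>) * ((1 - \<rho>) ^ n * card U)"
    using rs(3) \<rho> unfolding W_def by (intro mult_left_mono) auto
  finally have "card {u \<in> W. \<not> P r u} \<le> (1 - \<rho>) ^ Suc n * card U" by (simp add: mult.assoc)
  moreover have "{u \<in> W. \<not> P r u} = {u \<in> U. \<forall>r'\<in>set (r # rs). \<not> P r' u}"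
    unfolding W_def by auto
  ultimately show ?case using rs r by (intro exI[of _ "r # rs"]) auto
qed

text \<open>For fixed g, a row with g(r c) = x c on \<open>T\<close> is forced to be the preimage of
  x there and is free on the other columns. Different g give disjoint sets of rows because x takes
  two distinct values, at i and j.\<close>

lemma card_covering_rows:
  assumes S: "finite S" and G: "sharp_family S G" "finite G"
    and T: "T \<subseteq> C" "finite C" and x: "x \<in> T \<rightarrow> S"
    and ij: "i \<in> T" "j \<in> T" "x i \<noteq> x j"
  shows "card {r \<in> C \<rightarrow>\<^sub>E S. \<exists>g\<in>G. \<forall>c\<in>T. g (r c) = x c} = card G * card S ^ (card C - card T)"
proof -
  let ?A = "\<lambda>g. {r \<in> C \<rightarrow>\<^sub>E S. \<forall>c\<in>T. g (r c) = x c}"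
  have A: "?A g = (\<Pi>\<^sub>E c\<in>C. if c \<in> T then {the_inv_into S g (x c)} else S)" if g: "g \<in> G" for g
  proof -
    have bij: "bij_betw g S S" using G g by (auto simp: sharp_family_def)
    then have eq: "y \<in> S \<and> g y = z \<longleftrightarrow> y = the_inv_into S g z" if "z \<in> S" for y z
      using that by (metis bij_betw_def f_the_inv_into_f_bij_betw the_inv_into_f_eq the_inv_into_into order_refl)
    have "r \<in> ?A g \<longleftrightarrow> r \<in> (\<Pi>\<^sub>E c\<in>C. if c \<in> T then {the_inv_into S g (x c)} else S)" for r
      using eq x T unfolding PiE_iff by (auto simp: Pi_iff) blast+
    then show ?thesis by blast
  qed
  have fin: "finite (?A g)" for g
    using finite_PiE[OF T(2), of "\<lambda>_. S"] S by (intro finite_subset[of "?A g" "C \<rightarrow>\<^sub>E S"]) auto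
  have cardA: "card (?A g) = card S ^ (card C - card T)" if g: "g \<in> G" for g
  proof -
    have "card (?A g) = (\<Prod>c\<in>C. if c \<in> T then 1 else card S)"
      unfolding A[OF g] card_PiE[OF T(2)] by (intro prod.cong) auto
    also have "\<dots> = card S ^ card (C - T)"
      using T(2) by (simp add: prod.If_cases Diff_eq)
    finally show ?thesis using T by (simp add: card_Diff_subset finite_subset)
  qed
  have "{r \<in> C \<rightarrow>\<^sub>E S. \<exists>g\<in>G. \<forall>c\<in>T. g (r c) = x c} = (\<Union>g\<in>G. ?A g)" by auto
  also have "card \<dots> = (\<Sum>g\<in>G. card (?A g))"
  proof (rule card_UN_disjoint[OF G(2)])
    show "\<forall>g\<in>G. \<forall>h\<in>G. g \<noteq> h \<longrightarrow> ?A g \<inter> ?A h = {}"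
    proof (intro ballI impI equals0I)
      fix g h r assume gh: "g \<in> G" "h \<in> G" "g \<noteq> h" and r: "r \<in> ?A g \<inter> ?A h"
      then have eq: "g (r i) = x i" "g (r j) = x j" "h (r i) = x i" "h (r j) = x j"
        using ij(1,2) by auto
      \<comment> \<open>Thus g and h agree at two distinct points of \<open>S\<close>, and sharpness
        forces g = h.\<close>
      then have "r i \<noteq> r j" using ij(3) by metis
      moreover have "r i \<in> S" "r j \<in> S" using r ij T by (auto simp: PiE_iff)
      moreover have "g (r i) = h (r i)" "g (r j) = h (r j)" using eq by simp_all
      ultimately show False using G(1) gh unfolding sharp_family_def by metis
    qed
  qed (use fin in auto)
  also have "\<dots> = card G * card S ^ (card C - card T)" using cardA by simp
  finally show ?thesis .
qed

section \<open>From few uncovered pairs to a covering array\<close>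

lemma CAN_le:
  fixes rows :: "(nat \<Rightarrow> nat) list"
  assumes "finite S" "card S = v"
    and "\<And>r c. r \<in> set rows \<Longrightarrow> c < k \<Longrightarrow> r c \<in> S"
    and "\<And>T x. T \<subseteq> {..<k} \<Longrightarrow> card T = t \<Longrightarrow> x \<in> T \<rightarrow>\<^sub>E S \<Longrightarrow> \<exists>r\<in>set rows. \<forall>c\<in>T. r c = x c"
  shows "CAN t k v \<le> length rows"
proof -
  have "covering_array S (length rows) t k v (\<lambda>i. rows ! i)"
    unfolding covering_array_def using assms by (auto simp: in_set_conv_nth Bex_def) (metis)
  then show ?thesis unfolding CAN_def by (intro Least_le) blast
qed

text \<open>Removing one chosen point from each member of \<open>B\<close> costs at most
  \<open>card B\<close> points and leaves no member intact.\<close>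

lemma exists_large_hitting_complement:
  assumes C: "finite C" and B: "finite B" "\<And>T. T \<in> B \<Longrightarrow> T \<noteq> {}"
    and card: "k + card B \<le> card C"
  shows "\<exists>D. D \<subseteq> C \<and> card D = k \<and> (\<forall>T\<in>B. \<not> T \<subseteq> D)"
proof -
  obtain f where f: "\<And>T. T \<in> B \<Longrightarrow> f T \<in> T" using B(2) by (metis ex_in_conv)
  have "k \<le> card C - card B" using card by simp
  also have "\<dots> \<le> card (C - f ` B)"
    using diff_card_le_card_Diff[of "f ` B" C] card_image_le[OF B(1), of f] B(1) by simp
  finally obtain D where "D \<subseteq> C - f ` B" "card D = k" "finite D"
    using obtain_subset_with_card_n by metis
  then show ?thesis using f by blast
qed

text \<open>At most k column sets carry an uncovered non-constant word. Deleting one column from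
  each leaves k good columns out of 2k; on these the images of the rows under \<open>G\<close> cover
  all non-constant words, and v constant rows cover the rest.\<close>

lemma CAN_le_of_uncovered:
  fixes S :: "nat set"
  assumes S: "finite S" "card S = v" and G: "sharp_family S G" "finite G"
    and t: "t > 0" and rs: "set rs \<subseteq> {..<2 * k} \<rightarrow>\<^sub>E S"
    and unc: "card {(T, x). T \<subseteq> {..<2 * k} \<and> card T = t \<and> x \<in> T \<rightarrow>\<^sub>E S \<and> (\<exists>i\<in>T. \<exists>j\<in>T. x i \<noteq> x j) \<and>
      (\<forall>r\<in>set rs. \<not> (\<exists>g\<in>G. \<forall>c\<in>T. g (r c) = x c))} \<le> k" (is "card ?U \<le> k")
  shows "CAN t k v \<le> card G * length rs + v"
proof -
  have finU: "finite ?U"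
  proof (rule finite_subset)
    show "?U \<subseteq> (SIGMA T:Pow {..<2 * k}. T \<rightarrow>\<^sub>E S)" by auto
    show "finite (SIGMA T:Pow {..<2 * k}. T \<rightarrow>\<^sub>E S)"
      using S by (intro finite_SigmaI finite_PiE) (auto intro: finite_subset)
  qed
  \<comment> \<open>Several words may be uncovered on the same columns; the deletion depends only on
    the column sets.\<close>
  have "card (fst ` ?U) \<le> k" using card_image_le[OF finU, of fst] unc by simp
  then have large: "k + card (fst ` ?U) \<le> card {..<2 * k}" by simp
  have ne: "T \<noteq> {}" if "T \<in> fst ` ?U" for T
  proof -
    from that have "card T = t" by (elim imageE) (simp split: prod.splits)
    then show ?thesis using t by (intro notI) simp
  qed
  have "\<exists>D. D \<subseteq> {..<2 * k} \<and> card D = k \<and> (\<forall>T\<in>fst ` ?U. \<not> T \<subseteq> D)"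
    by (rule exists_large_hitting_complement[OF finite_lessThan finite_imageI[OF finU] ne large])
  then obtain D where D: "D \<subseteq> {..<2 * k}" "card D = k" "\<forall>T\<in>fst ` ?U. \<not> T \<subseteq> D"
    by (elim exE conjE) (rule that)
  have "finite D" using D(1) finite_subset by blast
  then obtain e where e: "bij_betw e {..<k} D"
    using finite_same_card_bij[of "{..<k}" D] D(2) by auto
  have eD: "e c \<in> D" if "c < k" for c using e that by (auto simp: bij_betw_def)
  obtain gs where gs: "set gs = G" "distinct gs" using finite_distinct_list[OF G(2)] by blast
  obtain ss where ss: "set ss = S" "distinct ss" using finite_distinct_list[OF S(1)] by blast
  \<comment> \<open>\<open>e\<close> relabels the surviving columns as 0, ..., k - 1.\<close>
  define rows where "rows = concat (map (\<lambda>r. map (\<lambda>g c. g (r (e c))) gs) rs) @ map (\<lambda>s c. s) ss"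
  have set_rows: "set rows = {\<lambda>c. g (r (e c)) | g r. g \<in> G \<and> r \<in> set rs} \<union> {\<lambda>c. s | s. s \<in> S}"
    unfolding rows_def using gs ss by auto
  have "length rows = card G * length rs + v"
    unfolding rows_def using gs ss S
    by (simp add: length_concat o_def sum_list_triv distinct_card[symmetric])
  moreover have "CAN t k v \<le> length rows"
  proof (rule CAN_le[OF S])
    fix r c assume r: "r \<in> set rows" and c: "c < (k::nat)"
    have "g (r' (e c)) \<in> S" if "g \<in> G" "r' \<in> set rs" for g r'
    proof -
      have "r' (e c) \<in> S" using rs that eD[OF c] D(1) by (auto simp: PiE_iff)
      then show ?thesis using G(1) that by (auto simp: sharp_family_def bij_betw_def)
    qed
    then show "r c \<in> S" using r unfolding set_rows by auto
  next
    fix T x assume T: "T \<subseteq> {..<k}" "card T = t" and x: "x \<in> T \<rightarrow>\<^sub>E S"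
    show "\<exists>r\<in>set rows. \<forall>c\<in>T. r c = x c"
    proof (cases "\<exists>i\<in>T. \<exists>j\<in>T. x i \<noteq> x j")
      case False
      obtain i where i: "i \<in> T" using T t by fastforce
      then have "(\<lambda>c. x i) \<in> set rows" unfolding set_rows using x by auto
      moreover have "\<forall>c\<in>T. x i = x c" using False i by blast
      ultimately show ?thesis by (intro bexI[of _ "\<lambda>c. x i"])
    next
      case True
      have inj: "inj_on e T" using e T(1) by (meson bij_betw_def inj_on_subset)
      define x' where "x' = (\<lambda>c\<in>e ` T. x (the_inv_into T e c))"
      have x': "x' (e c) = x c" if "c \<in> T" for c
        using that inj by (simp add: x'_def the_inv_into_f_f)
      have "e ` T \<subseteq> D" using eD T(1) by auto
      have notU: "(e ` T, x') \<notin> ?U"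
      proof
        assume "(e ` T, x') \<in> ?U"
        then have "e ` T \<in> fst ` ?U" by (rule image_eqI[rotated]) simp
        from bspec[OF D(3) this] \<open>e ` T \<subseteq> D\<close> show False by (rule notE)
      qed
      have "e ` T \<subseteq> {..<2 * k}" using \<open>e ` T \<subseteq> D\<close> D(1) by blast
      moreover have "card (e ` T) = t" using inj T by (simp add: card_image)
      moreover have "x' \<in> e ` T \<rightarrow>\<^sub>E S" using x x' by (auto simp: PiE_iff) (simp add: x'_def)
      moreover have "\<exists>i\<in>e ` T. \<exists>j\<in>e ` T. x' i \<noteq> x' j" using True x' by auto
      ultimately have "\<exists>r\<in>set rs. \<exists>g\<in>G. \<forall>c\<in>e ` T. g (r c) = x' c" using notU by simp
      then obtain r g where "r \<in> set rs" "g \<in> G" "\<forall>c\<in>e ` T. g (r c) = x' c" by blast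
      then show ?thesis unfolding set_rows using x' by (intro bexI[of _ "\<lambda>c. g (r (e c))"]) auto
    qed
  qed
  ultimately show ?thesis by simp
qed

text \<open>The assumption says that after n greedy rounds on 2k columns at most k of the (2k)^t v^t
  pairs can remain, which is exactly what the deletion step tolerates.\<close>

lemma CAN_le_of_large:
  fixes t v k n :: nat
  assumes t: "t \<ge> 2" and v: "primepow v"
    and n: "(2 * real k) ^ t * real v ^ t * (1 - (real v - 1) / real v ^ (t - 1)) ^ n \<le> real k"
  shows "CAN t k v \<le> v * (v - 1) * n + v"
proof -
  define S where "S = {..<v}"
  define \<rho> where "\<rho> = (real v - 1) / real v ^ (t - 1)"
  have S: "finite S" "card S = v" unfolding S_def by simp_all
  have v2: "v \<ge> 2" using primepow_gt_Suc_0[OF v] by simp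
  have "real v ^ 1 \<le> real v ^ (t - 1)" using v2 t by (intro power_increasing) auto
  then have "real v \<le> real v ^ (t - 1)" by (simp only: power_one_right)
  then have \<rho>: "\<rho> \<le> 1" unfolding \<rho>_def using v2 by (subst divide_le_eq_1_pos) linarith+
  obtain G where G: "sharp_family S G" "finite G" "card G = v * (v - 1)"
    using exists_sharp_family_primepow[OF v S] by blast
  define R where "R = {..<2 * k} \<rightarrow>\<^sub>E S"
  define U where "U = {(T, x). T \<subseteq> {..<2 * k} \<and> card T = t \<and> x \<in> T \<rightarrow>\<^sub>E S \<and> (\<exists>i\<in>T. \<exists>j\<in>T. x i \<noteq> x j)}"
  define P where "P = (\<lambda>(r :: nat \<Rightarrow> nat) (T, x). \<exists>g\<in>G. \<forall>c\<in>T. g (r c) = (x c :: nat))"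
  have finR: "finite R" unfolding R_def using S by (intro finite_PiE) auto
  have cardR: "card R = v ^ (2 * k)" unfolding R_def using S by (simp add: card_PiE)
  then have R0: "R \<noteq> {}" using v2 by auto
  let ?V = "SIGMA T:{T. T \<subseteq> {..<2 * k} \<and> card T = t}. T \<rightarrow>\<^sub>E S"
  have finT: "finite {T. T \<subseteq> {..<2 * k} \<and> card T = t}" by (rule finite_subset[of _ "Pow {..<2 * k}"]) auto
  have finV: "finite ?V"
    using S finT by (intro finite_SigmaI finite_PiE) (auto intro: finite_subset)
  have UV: "U \<subseteq> ?V" unfolding U_def by auto
  have finU: "finite U" using finite_subset[OF UV finV] .
  have "card ?V = (\<Sum>T\<in>{T. T \<subseteq> {..<2 * k} \<and> card T = t}. card (T \<rightarrow>\<^sub>E S))"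
    using S finT by (intro card_SigmaI) (auto intro!: finite_PiE intro: finite_subset)
  also have "\<dots> = (\<Sum>T\<in>{T. T \<subseteq> {..<2 * k} \<and> card T = t}. v ^ t)"
    using S by (intro sum.cong) (auto simp: card_PiE finite_subset)
  \<comment> \<open>The count includes constant words and then bounds the binomial coefficient by a
    power; such constant factors do not affect the limit.\<close>
  also have "\<dots> = (2 * k choose t) * v ^ t" using n_subsets[of "{..<2 * k}" t] by simp
  also have "\<dots> \<le> (2 * k) ^ t * v ^ t"
  proof (rule mult_right_mono)
    show "2 * k choose t \<le> (2 * k) ^ t"
    proof (cases "t \<le> 2 * k")
      case True
      then show ?thesis by (rule binomial_le_pow)
    qed (simp add: binomial_eq_0)
  qed simp
  finally have "card U \<le> (2 * k) ^ t * v ^ t" using card_mono[OF finV UV] by linarith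
  then have "real (card U) \<le> real ((2 * k) ^ t * v ^ t)" by (rule of_nat_mono)
  then have cardU: "real (card U) \<le> (2 * real k) ^ t * real v ^ t" by simp
  have cov: "\<rho> * card R \<le> card {r \<in> R. P r u}" if "u \<in> U" for u
  proof -
    obtain T x i j where u: "u = (T, x)" "T \<subseteq> {..<2 * k}" "card T = t" "x \<in> T \<rightarrow>\<^sub>E S"
      "i \<in> T" "j \<in> T" "x i \<noteq> x j"
      using \<open>u \<in> U\<close> unfolding U_def by auto
    \<comment> \<open>The existence of \<open>T\<close> gives this bound, so the subtraction in the
      exponent 2k - t is exact.\<close>
    have le: "t \<le> 2 * k" using card_mono[OF _ u(2)] u(3) by simp
    have "x \<in> T \<rightarrow> S" using u(4) by auto
    from card_covering_rows[OF S(1) G(1,2) u(2) finite_lessThan this u(5-7)]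
    have "card {r \<in> R. P r u} = v * (v - 1) * v ^ (2 * k - t)"
      unfolding R_def P_def u(1) prod.case u(3) S(2) G(3) card_lessThan .
    then have "real (card {r \<in> R. P r u}) = (real v - 1) * (real v * real v ^ (2 * k - t))"
      using v2 by (simp add: of_nat_diff)
    moreover have "\<rho> * card R = (real v - 1) * (real v * real v ^ (2 * k - t))"
    proof -
      \<comment> \<open>This splitting cancels the denominator v^(t-1) of \<rho>, matching the count
        v(v - 1) v^(2k-t).\<close>
      have "2 * k = (t - 1) + Suc (2 * k - t)" using le t by simp
      then have "v ^ (2 * k) = v ^ (t - 1) * v ^ Suc (2 * k - t)" by (metis power_add)
      then show ?thesis unfolding \<rho>_def cardR using v2 by simp
    qed
    ultimately show ?thesis by simp
  qed
  have "\<exists>rs. length rs = n \<and> set rs \<subseteq> R \<and>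
      card {u \<in> U. \<forall>r\<in>set rs. \<not> P r u} \<le> (1 - \<rho>) ^ n * card U"
    by (rule exists_list_covering[OF finR R0 finU \<rho> cov])
  then obtain rs where rs: "length rs = n" "set rs \<subseteq> R"
    "card {u \<in> U. \<forall>r\<in>set rs. \<not> P r u} \<le> (1 - \<rho>) ^ n * card U"
    by blast
  have "(1 - \<rho>) ^ n * card U \<le> (1 - \<rho>) ^ n * ((2 * real k) ^ t * real v ^ t)"
    using cardU \<rho> by (intro mult_left_mono) auto
  also have "\<dots> \<le> real k" using n unfolding \<rho>_def by (simp add: mult_ac)
  finally have "card {u \<in> U. \<forall>r\<in>set rs. \<not> P r u} \<le> k" using rs(3) by linarith
  moreover have "{u \<in> U. \<forall>r\<in>set rs. \<not> P r u} =
    {(T, x). T \<subseteq> {..<2 * k} \<and> card T = t \<and> x \<in> T \<rightarrow>\<^sub>E S \<and> (\<exists>i\<in>T. \<exists>j\<in>T. x i \<noteq> x j) \<and>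
      (\<forall>r\<in>set rs. \<not> (\<exists>g\<in>G. \<forall>c\<in>T. g (r c) = x c))}"
  proof (rule Set.set_eqI, goal_cases)
    case (1 u)
    show ?case by (cases u) (simp add: U_def P_def)
  qed
  ultimately show ?thesis
    using CAN_le_of_uncovered[OF S G(1,2), of t rs k] t rs G(3) unfolding R_def by simp
qed

section \<open>Choice of the number of rows and the limit superior\<close>

theorem theorem7:
  fixes t v :: nat
  assumes "t \<ge> 2" and "primepow v"
  shows "d t v \<le> ereal (real v * (real v - 1) * (real t - 1) /
           ln (real v ^ (t - 1) / (real v ^ (t - 1) - real v + 1)))"
proof -
  define V where "V = real v ^ (t - 1)"
  define L where "L = ln (V / (V - real v + 1))"
  define A where "A = real v * (real v - 1)"
  \<comment> \<open>This is the part of ln ((2kv)^t) that does not depend on k.\<close>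
  define c where "c = real t * ln (2 * real v)"
  have v2: "v \<ge> 2" using primepow_gt_Suc_0[OF assms(2)] by simp
  have "real v ^ 1 \<le> V" unfolding V_def using v2 assms(1) by (intro power_increasing) auto
  then have den: "V - real v + 1 > 0" by simp
  have V0: "V > 0" unfolding V_def using v2 by simp
  \<comment> \<open>The fraction of pairs left by one greedy round, equal to exp (-L).\<close>
  define \<beta> where "\<beta> = 1 - (real v - 1) / V"
  have \<beta>: "\<beta> = (V - real v + 1) / V"
    unfolding \<beta>_def using V0 by (simp add: field_simps)
  then have \<beta>0: "\<beta> > 0" using den V0 by simp
  have ln\<beta>: "ln \<beta> = - L" unfolding \<beta> L_def using den V0 by (simp add: ln_div)
  have L0: "L > 0" unfolding L_def using den V0 v2 by (intro ln_gt_zero) (simp add: field_simps)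
  have A0: "A \<ge> 0" unfolding A_def using v2 by simp
  have bound: "real (CAN t k v) / ln (real k) \<le> A * (real t - 1) / L + (A * (c / L + 1) + real v) / ln (real k)"
    if k: "k \<ge> 2" for k
  proof -
    have lnk: "ln (real k) > 0" using k by simp
    \<comment> \<open>The real solution of (2kv)^t \<beta>^z = k. The target k on the right, instead
      of 1, turns t ln k into (t - 1) ln k.\<close>
    define z where "z = ((real t - 1) * ln (real k) + c) / L"
    define n where "n = nat \<lceil>z\<rceil>"
    have zL: "z * L = (real t - 1) * ln (real k) + c" unfolding z_def using L0 by simp
    \<comment> \<open>Nonnegativity keeps \<open>nat\<close> from truncating, so rounding up costs
      at most one row.\<close>
    have z0: "z \<ge> 0" unfolding z_def c_def using L0 lnk v2 assms(1) by simp
    have nz: "z \<le> real n" "real n \<le> z + 1" unfolding n_def using z0 by linarith+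
    have "\<beta> ^ n = exp (real n * ln \<beta>)" using \<beta>0 by (simp add: exp_of_nat_mult)
    also have "\<dots> \<le> exp (- (z * L))" unfolding ln\<beta> using nz L0 by (simp add: mult_right_mono)
    also have "- (z * L) = ln (real k) - real t * (ln (real k) + ln (2 * real v))"
      using zL unfolding c_def by (simp add: algebra_simps)
    also have "ln (real k) + ln (2 * real v) = ln (2 * real k * real v)"
      using k v2 by (simp add: ln_mult)
    also have "exp (ln (real k) - real t * ln (2 * real k * real v)) = real k / (2 * real k * real v) ^ t"
      using k v2 by (simp add: exp_diff exp_of_nat_mult)
    finally have "(2 * real k * real v) ^ t * \<beta> ^ n \<le> real k"
      using k v2 by (simp add: field_simps)
    then have "CAN t k v \<le> v * (v - 1) * n + v"
      using CAN_le_of_large[OF assms, of k n] unfolding \<beta>_def V_def by (simp add: power_mult_distrib)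
    then have "real (CAN t k v) \<le> real (v * (v - 1) * n + v)" by (rule of_nat_mono)
    also have "\<dots> = A * real n + real v" unfolding A_def using v2 by (simp add: of_nat_diff)
    also have "\<dots> \<le> A * (z + 1) + real v" using nz A0 by (simp add: mult_left_mono)
    finally have "real (CAN t k v) / ln (real k) \<le> (A * (z + 1) + real v) / ln (real k)"
      using lnk by (intro divide_right_mono) auto
    also have "\<dots> = A * (real t - 1) / L + (A * (c / L + 1) + real v) / ln (real k)"
    proof -
      have "A * (z + 1) + real v = A * (real t - 1) / L * ln (real k) + (A * (c / L + 1) + real v)"
        unfolding z_def by (simp add: add_divide_distrib diff_divide_distrib algebra_simps)
      then show ?thesis using lnk by (simp add: add_divide_distrib)
    qed
    finally show ?thesis .
  qed
  \<comment> \<open>The numerator of the second summand is independent of k, so rounding,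
    \<open>c\<close> and the constant rows all vanish in the limit.\<close>
  have "(\<lambda>k. A * (real t - 1) / L + (A * (c / L + 1) + real v) / ln (real k))
      \<longlonglongrightarrow> A * (real t - 1) / L + 0"
    by (intro tendsto_add tendsto_const tendsto_divide_0[OF tendsto_const]
        filterlim_at_top_imp_at_infinity filterlim_compose[OF ln_at_top] filterlim_real_sequentially)
  then have lim: "limsup (\<lambda>k. ereal (A * (real t - 1) / L + (A * (c / L + 1) + real v) / ln (real k)))
      = ereal (A * (real t - 1) / L)"
    by (intro lim_imp_Limsup) auto
  \<comment> \<open>The comparison starts at k = 2, where ln k is positive.\<close>
  have "d t v \<le> limsup (\<lambda>k. ereal (A * (real t - 1) / L + (A * (c / L + 1) + real v) / ln (real k)))"
    unfolding d_def using bound by (intro Limsup_mono eventually_sequentiallyI[of 2]) simp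
  then show ?thesis unfolding lim unfolding A_def L_def V_def .
qed

end
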